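(* For each $N\in\{1,2,\dots\}$ let $w^{(N)}_1,\dots,w^{(N)}_N>0$ and let $\tau^{(N)}_1,\dots,\tau^{(N)}_N$ be independent random variables with $\mathrm{P}[\tau^{(N)}_i\le t]=1-e^{-w^{(N)}_i t}$ for $t\ge0$ (the first jump times of the $N$ particles). Put $$y^{(N)}_C(t)=\frac1N\sum_{i=1}^N\chi_{\tau^{(N)}_i\le t},\qquad t\ge0.$$ Assume that the empirical distribution of jump rates converges weakly to a probability distribution $\lambda$ on $[0,\infty)$: $$\lambda^{(N)}(dw)=\frac1N\sum_{i=1}^N\delta(w-w^{(N)}_i)\,dw\ \to\ \lambda(dw),\qquad N\to\infty.$$ Then for each $t\ge0$, $$\lim_{N\to\infty}y^{(N)}_C(t)=y_C(t)\quad\text{in probability,}$$ where $$y_C(t)=1-\int_{[0,\infty)}e^{-wt}\,\lambda(dw),\qquad t\ge0.$$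
   Context: $\chi_A$ is $1$ if $A$ is true and $0$ if $A$ is false. In the stochastic ranking process of $N$ particles, particle $i$ jumps to the top of a queue at random times whose successive increments are i.i.d. exponential with rate $w^{(N)}_i$, independently among particles; $\tau^{(N)}_i$ is the first jump time of particle $i$, and $y^{(N)}_C(t)$ is the fraction of particles that have jumped by time $t$. *)

theory Defs
  imports "HOL-Probability.Probability"
begin

text \<open>The pushforward of the uniform distribution on \<open>{1..N}\<close> under \<open>i \<mapsto> w i\<close>, that is,
  the measure \<open>(1/N) (\<delta>(w 1) + \<dots> + \<delta>(w N))\<close> on the Borel sets of the real line.
  For \<open>N = 0\<close> it is the null measure.\<close>

definition empirical_distr :: "nat \<Rightarrow> (nat \<Rightarrow> real) \<Rightarrow> real measure" where
  "empirical_distr N w = distr (uniform_count_measure {1..N}) borel w"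

definition jumped_fraction :: "nat \<Rightarrow> (nat \<Rightarrow> 'a \<Rightarrow> real) \<Rightarrow> real \<Rightarrow> 'a \<Rightarrow> real" where
  "jumped_fraction N \<tau> t \<omega> = (1 / real N) * (\<Sum>i=1..N. of_bool (\<tau> i \<omega> \<le> t))"

definition limit_fraction :: "real measure \<Rightarrow> real \<Rightarrow> real" where
  "limit_fraction \<Lambda> t = 1 - (LINT w:{0..}|\<Lambda>. exp (- (w * t)))"

text \<open>Convergence in probability to a constant. As the limit is deterministic, each \<open>X n\<close> may live
  on its own probability space \<open>M n\<close>. The \<open>X n\<close> are meant to be Borel measurable.\<close>

definition tendsto_in_prob :: "(nat \<Rightarrow> 'a measure) \<Rightarrow> (nat \<Rightarrow> 'a \<Rightarrow> real) \<Rightarrow> real \<Rightarrow> bool" where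
  "tendsto_in_prob M X c \<longleftrightarrow>
    (\<forall>\<epsilon>>0. (\<lambda>n. measure (M n) {\<omega> \<in> space (M n). \<epsilon> < \<bar>X n \<omega> - c\<bar>}) \<longlonglongrightarrow> 0)"

end

theory Submission
  imports Defs "HOL-Real_Asymp.Real_Asymp"
begin

text \<open>For fixed \<open>t\<close> the indicators \<open>of_bool (\<tau> i \<omega> \<le> t)\<close> are independent and bounded, so by Hoeffding's
  inequality their average concentrates around its mean
  \<open>1 - (1/N) (exp (- w 1 * t) + \<dots> + exp (- w N * t))\<close>. That mean is
  one minus the integral of a bounded continuous function against the empirical distribution, and
  hence converges by weak convergence.\<close>

text \<open>The bound depends only on \<open>N\<close> and \<open>\<epsilon>\<close>, not on the
  laws of the \<open>\<tau> i\<close>. So it applies to each \<open>N\<close> separately, on that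
  \<open>N\<close>'s own probability space, whatever the jump rates are.\<close>

lemma (in prob_space) jumped_fraction_concentration:
  assumes N: "N \<ge> 1" and indep_\<tau>: "indep_vars (\<lambda>_. borel) \<tau> {1..N}" and "\<epsilon> \<ge> 0"
  shows "prob {\<omega> \<in> space M. \<epsilon> \<le> \<bar>jumped_fraction N \<tau> t \<omega> -
             (\<Sum>i=1..N. prob {\<omega> \<in> space M. \<tau> i \<omega> \<le> t}) / real N\<bar>}
           \<le> 2 * exp (- 2 * real N * \<epsilon>\<^sup>2)"
proof -
  define X :: "nat \<Rightarrow> 'a \<Rightarrow> real" where "X = (\<lambda>i \<omega>. of_bool (\<tau> i \<omega> \<le> t))"
  define \<mu> where "\<mu> = (\<Sum>i=1..N. expectation (X i))"
  have "indep_vars (\<lambda>_. borel) (\<lambda>i \<omega>. of_bool (\<tau> i \<omega> \<le> t) :: real) {1..N}"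
    by (rule indep_vars_compose2[OF indep_\<tau>]) measurable
  then interpret Hoeffding_ineq M "{1..N}" X "\<lambda>_. 0" "\<lambda>_. 1" \<mu>
    by unfold_locales (auto simp: \<mu>_def X_def)
  have "expectation (X i) = prob {\<omega> \<in> space M. \<tau> i \<omega> \<le> t}" if "i \<in> {1..N}" for i
  proof -
    \<comment> \<open>Independence carries the measurability of each \<open>\<tau> i\<close>; it
      makes the event measurable, so that the expectation of its indicator is its
      probability.\<close>
    have [measurable]: "random_variable borel (\<tau> i)"
      using indep_\<tau> that unfolding indep_vars_def by blast
    have "expectation (X i) = expectation (indicator {\<omega> \<in> space M. \<tau> i \<omega> \<le> t})"
      by (rule Bochner_Integration.integral_cong) (auto simp: X_def)
    then show ?thesis
      by simp
  qed
  then have \<mu>: "\<mu> = (\<Sum>i=1..N. prob {\<omega> \<in> space M. \<tau> i \<omega> \<le> t})"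
    unfolding \<mu>_def by (intro sum.cong) auto
  have "\<epsilon> \<le> \<bar>jumped_fraction N \<tau> t \<omega> - \<mu> / real N\<bar> \<longleftrightarrow>
        real N * \<epsilon> \<le> \<bar>(\<Sum>i=1..N. X i \<omega>) - \<mu>\<bar>" for \<omega>
  proof -
    have "jumped_fraction N \<tau> t \<omega> - \<mu> / real N = ((\<Sum>i=1..N. X i \<omega>) - \<mu>) / real N"
      by (simp add: jumped_fraction_def X_def diff_divide_distrib)
    then show ?thesis
      using N by (simp add: pos_le_divide_eq mult.commute)
  qed
  then have "prob {\<omega> \<in> space M. \<epsilon> \<le> \<bar>jumped_fraction N \<tau> t \<omega> - \<mu> / real N\<bar>} =
        prob {\<omega> \<in> space M. real N * \<epsilon> \<le> \<bar>(\<Sum>i=1..N. X i \<omega>) - \<mu>\<bar>}"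
    by simp
  also have "\<dots> \<le> 2 * exp (- 2 * (real N * \<epsilon>)\<^sup>2 / (\<Sum>i=1..N. (1 - 0)\<^sup>2))"
    using N \<open>\<epsilon> \<ge> 0\<close> by (intro Hoeffding_ineq_abs_ge) auto
  \<comment> \<open>The squared widths of the ranges add up to \<open>N\<close>, which cancels one
    of the two factors \<open>N\<close> in the numerator.\<close>
  also have "- 2 * (real N * \<epsilon>)\<^sup>2 / (\<Sum>i=1..N. (1 - 0)\<^sup>2) = - 2 * real N * \<epsilon>\<^sup>2"
    using N by (simp add: power2_eq_square)
  finally show ?thesis
    unfolding \<mu> .
qed

lemma real_distribution_empirical_distr:
  assumes "N \<ge> 1"
  shows "real_distribution (empirical_distr N w)"
proof -
  interpret prob_space "uniform_count_measure {1..N}"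
    using assms by (intro prob_space_uniform_count_measure) auto
  show ?thesis
    unfolding empirical_distr_def by (rule real_distribution_distr) simp
qed

text \<open>Change of variables. It covers \<open>N = 0\<close> too: the measure is then null, and
  division by zero gives 0 on the right.\<close>

lemma integral_empirical_distr:
  fixes f :: "real \<Rightarrow> real"
  assumes "f \<in> borel_measurable borel"
  shows "integral\<^sup>L (empirical_distr N w) f = (\<Sum>i=1..N. f (w i)) / real N"
proof -
  have "integral\<^sup>L (empirical_distr N w) f = (\<integral>i. f (w i) \<partial>uniform_count_measure {1..N})"
    unfolding empirical_distr_def using assms by (intro integral_distr) simp_all
  then show ?thesis
    by (simp add: integral_uniform_count_measure)
qed

text \<open>The averages are Laplace transforms at \<open>t\<close> of the empirical distributions,
  so weak convergence gives the limit once the exponential is replaced by a test function that is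
  bounded on the whole line.\<close>

lemma tendsto_mean_exp:
  assumes w: "\<And>N i. N \<ge> 1 \<Longrightarrow> i \<in> {1..N} \<Longrightarrow> w N i \<ge> 0"
    and \<Lambda>: "real_distribution \<Lambda>" and \<Lambda>_nonneg: "measure \<Lambda> {0..} = 1"
    and conv: "weak_conv_m (\<lambda>N. empirical_distr N (w N)) \<Lambda>"
    and "t \<ge> 0"
  shows "(\<lambda>N. (\<Sum>i=1..N. exp (- (w N i * t))) / real N) \<longlonglongrightarrow> (LINT w:{0..}|\<Lambda>. exp (- (w * t)))"
proof -
  interpret \<Lambda>: real_distribution \<Lambda>
    by fact
  \<comment> \<open>For \<open>t > 0\<close> the exponential is unbounded on the negative half-line.
    Cutting off with \<open>max 0 x\<close> freezes it at 1 there, which keeps it continuous and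
    changes nothing at the nonnegative rates.\<close>
  define f :: "real \<Rightarrow> real" where "f = (\<lambda>x. exp (- (max 0 x * t)))"
  have [measurable]: "f \<in> borel_measurable borel"
    unfolding f_def by measurable
  \<comment> \<open>The empirical distribution of zero particles is not a probability measure.\<close>
  have "weak_conv_m (\<lambda>N. empirical_distr (Suc N) (w (Suc N))) \<Lambda>"
    using conv unfolding weak_conv_m_def weak_conv_def by (auto intro: LIMSEQ_Suc)
  then have "(\<lambda>N. integral\<^sup>L (empirical_distr (Suc N) (w (Suc N))) f) \<longlonglongrightarrow> integral\<^sup>L \<Lambda> f"
  proof (rule weak_conv_imp_integral_bdd_continuous_conv[rotated 2])
    show "isCont f x" for x
      unfolding f_def by (intro continuous_intros)
    show "norm (f x) \<le> 1" for x
      using \<open>t \<ge> 0\<close> by (simp add: f_def)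
  qed (simp_all add: real_distribution_empirical_distr \<Lambda>)
  then have "(\<lambda>N. integral\<^sup>L (empirical_distr N (w N)) f) \<longlonglongrightarrow> integral\<^sup>L \<Lambda> f"
    by (rule LIMSEQ_imp_Suc)
  moreover have "integral\<^sup>L (empirical_distr N (w N)) f = (\<Sum>i=1..N. exp (- (w N i * t))) / real N" for N
  proof -
    have "f (w N i) = exp (- (w N i * t))" if "i \<in> {1..N}" for i
      using w[of N i] that by (simp add: f_def)
    then show ?thesis
      by (simp add: integral_empirical_distr)
  qed
  moreover have "integral\<^sup>L \<Lambda> f = (LINT w:{0..}|\<Lambda>. exp (- (w * t)))"
    unfolding set_lebesgue_integral_def
  proof (rule integral_cong_AE)
    \<comment> \<open>On negative \<open>x\<close> the two integrands differ, being 1 and 0, but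
      \<open>\<Lambda>\<close> gives these points no mass.\<close>
    have "AE x in \<Lambda>. x \<in> {0..}"
      using \<Lambda>_nonneg by (subst \<Lambda>.AE_in_set_eq_1) simp_all
    then show "AE x in \<Lambda>. f x = indicator {0..} x *\<^sub>R exp (- (x * t))"
      by eventually_elim (simp add: f_def)
  qed measurable
  ultimately show ?thesis
    by simp
qed

theorem proposition2:
  fixes M :: "nat \<Rightarrow> 'a measure"
    and w :: "nat \<Rightarrow> nat \<Rightarrow> real"
    and \<tau> :: "nat \<Rightarrow> nat \<Rightarrow> 'a \<Rightarrow> real"
    and \<Lambda> :: "real measure"
    and t :: real
  assumes "\<And>N. N \<ge> 1 \<Longrightarrow> prob_space (M N)"
    and "\<And>N i. N \<ge> 1 \<Longrightarrow> i \<in> {1..N} \<Longrightarrow> w N i > 0"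
    and "\<And>N. N \<ge> 1 \<Longrightarrow> prob_space.indep_vars (M N) (\<lambda>_. borel) (\<tau> N) {1..N}"
    and "\<And>N i s. N \<ge> 1 \<Longrightarrow> i \<in> {1..N} \<Longrightarrow> s \<ge> 0 \<Longrightarrow>
           measure (M N) {\<omega> \<in> space (M N). \<tau> N i \<omega> \<le> s} = 1 - exp (- (w N i * s))"
    and "real_distribution \<Lambda>" and "measure \<Lambda> {0..} = 1"
    and "weak_conv_m (\<lambda>N. empirical_distr N (w N)) \<Lambda>"
    and "t \<ge> 0"
  shows "tendsto_in_prob M (\<lambda>N. jumped_fraction N (\<tau> N) t) (limit_fraction \<Lambda> t)"
  unfolding tendsto_in_prob_def
proof (intro allI impI)
  fix \<epsilon> :: real
  assume "\<epsilon> > 0"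
  define m where "m N = (\<Sum>i=1..N. measure (M N) {\<omega> \<in> space (M N). \<tau> N i \<omega> \<le> t}) / real N" for N
  have m_eq: "m N = 1 - (\<Sum>i=1..N. exp (- (w N i * t))) / real N" if "N \<ge> 1" for N
    using that assms(4)[OF that _ \<open>t \<ge> 0\<close>]
    by (simp add: m_def sum_subtractf diff_divide_distrib)
  have "(\<lambda>N. 1 - (\<Sum>i=1..N. exp (- (w N i * t))) / real N) \<longlonglongrightarrow> limit_fraction \<Lambda> t"
    unfolding limit_fraction_def
    using assms(2,5-8) by (intro tendsto_diff tendsto_const tendsto_mean_exp) (auto intro: less_imp_le)
  \<comment> \<open>The two sequences disagree at \<open>N = 0\<close>, where division by zero gives
    0 for \<open>m\<close> and 1 for the formula, so only eventual equality is available.\<close>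
  then have "m \<longlonglongrightarrow> limit_fraction \<Lambda> t"
    by (rule Lim_transform_eventually) (auto intro: eventually_mono[OF eventually_ge_at_top[of 1]] simp: m_eq)
  \<comment> \<open>Half of \<open>\<epsilon>\<close> is spent on the deterministic distance from
    the mean to the limit; the other half remains for the random fluctuation around the
    mean.\<close>
  then have m_close: "\<forall>\<^sub>F N in sequentially. \<bar>m N - limit_fraction \<Lambda> t\<bar> < \<epsilon> / 2"
    using \<open>\<epsilon> > 0\<close> by (auto dest: tendstoD[of _ _ _ "\<epsilon> / 2"] simp: dist_real_def)
  show "(\<lambda>N. measure (M N) {\<omega> \<in> space (M N). \<epsilon> < \<bar>jumped_fraction N (\<tau> N) t \<omega> - limit_fraction \<Lambda> t\<bar>}) \<longlonglongrightarrow> 0"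
  proof (rule tendsto_sandwich[OF _ _ tendsto_const])
    show "\<forall>\<^sub>F N in sequentially.
        measure (M N) {\<omega> \<in> space (M N). \<epsilon> < \<bar>jumped_fraction N (\<tau> N) t \<omega> - limit_fraction \<Lambda> t\<bar>}
          \<le> 2 * exp (- 2 * real N * (\<epsilon> / 2)\<^sup>2)"
      using m_close eventually_ge_at_top[of 1]
    proof eventually_elim
      case (elim N)
      interpret prob_space "M N"
        using assms(1) elim by blast
      have [measurable]: "random_variable borel (\<tau> N i)" if "i \<in> {1..N}" for i
        using assms(3)[of N] elim that unfolding indep_vars_def by blast
      \<comment> \<open>Monotonicity of the measure below requires the larger event to be
        measurable.\<close>
      have [measurable]: "random_variable borel (jumped_fraction N (\<tau> N) t)"
        unfolding jumped_fraction_def[abs_def] by measurable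
      have "prob {\<omega> \<in> space (M N). \<epsilon> < \<bar>jumped_fraction N (\<tau> N) t \<omega> - limit_fraction \<Lambda> t\<bar>}
          \<le> prob {\<omega> \<in> space (M N). \<epsilon> / 2 \<le> \<bar>jumped_fraction N (\<tau> N) t \<omega> - m N\<bar>}"
      proof (rule finite_measure_mono)
        have "\<epsilon> / 2 \<le> \<bar>x - m N\<bar>" if "\<epsilon> < \<bar>x - limit_fraction \<Lambda> t\<bar>" for x
          using that elim(1) by linarith
        then show "{\<omega> \<in> space (M N). \<epsilon> < \<bar>jumped_fraction N (\<tau> N) t \<omega> - limit_fraction \<Lambda> t\<bar>}
            \<subseteq> {\<omega> \<in> space (M N). \<epsilon> / 2 \<le> \<bar>jumped_fraction N (\<tau> N) t \<omega> - m N\<bar>}"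
          by blast
      qed measurable
      also have "\<dots> \<le> 2 * exp (- 2 * real N * (\<epsilon> / 2)\<^sup>2)"
        unfolding m_def using elim \<open>\<epsilon> > 0\<close> assms(3) by (intro jumped_fraction_concentration) auto
      finally show ?case .
    qed
    show "(\<lambda>N. 2 * exp (- 2 * real N * (\<epsilon> / 2)\<^sup>2)) \<longlonglongrightarrow> 0"
      using \<open>\<epsilon> > 0\<close> by real_asymp
  qed simp
qed

end
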